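(* Let $0<p<\infty$ and let $w$ be a weight on the unit disk $\mathbb{D}$ (not necessarily integrable and not necessarily radial) such that $A^p_w\neq\{0\}$. If the Korenblum domination principle holds for $A^p_w$ (that is, if at least one admissible radius exists), then the Korenblum radius $c(p)$, i.e. the supremum of all admissible radii for $A^p_w$, satisfies $c(p)<1$.
   Context: $\mathbb{D}=\{z\in\mathbb{C}:|z|<1\}$ and $dA=\frac1\pi\,dx\,dy$ is the normalized Lebesgue area measure on $\mathbb{D}$. A weight is a measurable function $w:\mathbb{D}\to[0,\infty)$ with $\int_{\mathbb{D}} w\,dA>0$ (possibly $+\infty$), equivalently $w$ is positive on some subset of $\mathbb{D}$ of positive measure. For $0<p<\infty$, $A^p_w$ is the set of all holomorphic functions $f$ in $\mathbb{D}$ with $\|f\|_{p,w}=\left(\int_{\mathbb{D}}|f|^p w\,dA\right)^{1/p}<\infty$. A number $c\in(0,1)$ is called an admissible radius for $A^p_w$ if for all $f,g\in A^p_w$ satisfying $|f(z)|\le|g(z)|$ whenever $c\le|z|<1$, one has $\|f\|_{p,w}\le\|g\|_{p,w}$. The Korenblum domination principle is said to hold for $A^p_w$ if there exists an admissible radius. The Korenblum radius $c(p)$ is the supremum of all admissible radii. *)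

theory Defs
  imports "HOL-Complex_Analysis.Complex_Analysis"
begin

text \<open>
  Functions on the unit disk are represented by total functions on the complex plane; no
  definition below depends on their values outside the disk.
\<close>

abbreviation unit_disk :: "complex set" where
  "unit_disk \<equiv> ball 0 1"

definition disk_area :: "complex measure" where
  "disk_area = scale_measure (ennreal (1 / pi)) (lebesgue_on unit_disk)"

definition disk_weight :: "(complex \<Rightarrow> real) \<Rightarrow> bool" where
  "disk_weight w \<longleftrightarrow>
     w \<in> borel_measurable disk_area \<and>
     (\<forall>z\<in>unit_disk. 0 \<le> w z) \<and>
     0 < (\<integral>\<^sup>+ z. ennreal (w z) \<partial>disk_area)"

text \<open>
  The convention at infinity is the intended one for positive exponents only.
\<close>

definition ennreal_powr :: "ennreal \<Rightarrow> real \<Rightarrow> ennreal" where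
  "ennreal_powr x a = (if x = \<infinity> then \<infinity> else ennreal (enn2real x powr a))"

definition bergman_norm :: "real \<Rightarrow> (complex \<Rightarrow> real) \<Rightarrow> (complex \<Rightarrow> complex) \<Rightarrow> ennreal" where
  "bergman_norm p w f =
     ennreal_powr (\<integral>\<^sup>+ z. ennreal (norm (f z) powr p * w z) \<partial>disk_area) (1 / p)"

definition bergman_space :: "real \<Rightarrow> (complex \<Rightarrow> real) \<Rightarrow> (complex \<Rightarrow> complex) set" where
  "bergman_space p w = {f. f holomorphic_on unit_disk \<and> bergman_norm p w f < \<infinity>}"

definition admissible_radius :: "real \<Rightarrow> (complex \<Rightarrow> real) \<Rightarrow> real \<Rightarrow> bool" where
  "admissible_radius p w c \<longleftrightarrow>
     0 < c \<and> c < 1 \<and>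
     (\<forall>f\<in>bergman_space p w. \<forall>g\<in>bergman_space p w.
        (\<forall>z. c \<le> norm z \<and> norm z < 1 \<longrightarrow> norm (f z) \<le> norm (g z)) \<longrightarrow>
        bergman_norm p w f \<le> bergman_norm p w g)"

definition korenblum_domination :: "real \<Rightarrow> (complex \<Rightarrow> real) \<Rightarrow> bool" where
  "korenblum_domination p w \<longleftrightarrow> (\<exists>c. admissible_radius p w c)"

text \<open>
  The supremum is meaningful only under \<^const>\<open>korenblum_domination\<close>: the supremum of
  the empty set of reals is unspecified.
\<close>

definition korenblum_radius :: "real \<Rightarrow> (complex \<Rightarrow> real) \<Rightarrow> real" where
  "korenblum_radius p w = Sup {c. admissible_radius p w c}"

end

theory Submission
  imports Defs
begin

text \<open>
  If the Korenblum radius were \<open>1\<close>, every \<open>c\<close> in \<open>(0, 1)\<close> would be admissible. For a nonzero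
  \<open>h\<close> in the space, comparing \<open>c h\<close> with \<open>z h\<close> gives
  \<open>c\<^sup>p \<integral> |h|\<^sup>p w \<le> \<integral> |z|\<^sup>p |h|\<^sup>p w\<close> for all such \<open>c\<close>. Letting \<open>c\<close> tend to \<open>1\<close> yields
  \<open>\<integral> (1 - |z|\<^sup>p) |h|\<^sup>p w = 0\<close>, so \<open>w\<close> vanishes almost everywhere because \<open>h\<close> has only countably
  many zeros.
\<close>

text \<open>Taking a root is strictly increasing, also at infinity, so comparisons of norms can be
  traded for comparisons of the integrals under the root.\<close>

lemma ennreal_powr_le_iff:
  assumes "0 < a"
  shows "ennreal_powr x a \<le> ennreal_powr y a \<longleftrightarrow> x \<le> y"
proof (cases "x = \<infinity> \<or> y = \<infinity>")
  case True
  then show ?thesis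
    by (auto simp: ennreal_powr_def top_unique)
next
  case False
  then obtain r s where rs: "x = ennreal r" "y = ennreal s" "0 \<le> r" "0 \<le> s"
    by (metis ennreal_cases infinity_ennreal_def)
  have "r powr a \<le> s powr a \<longleftrightarrow> r \<le> s"
    using rs(3,4) assms by (meson linorder_not_less powr_less_mono2 powr_mono2 less_imp_le)
  then show ?thesis
    using rs by (simp add: ennreal_powr_def ennreal_le_iff)
qed

lemma ennreal_powr_less_top_iff: "ennreal_powr x a < top \<longleftrightarrow> x < top"
  by (auto simp: ennreal_powr_def less_top[symmetric])

text \<open>Lowering the radius enlarges the annulus on which domination is demanded, so fewer pairs
  have to be compared.\<close>

lemma admissible_radius_antimono:
  assumes "admissible_radius p w c'" "0 < c" "c \<le> c'"
  shows "admissible_radius p w c"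
  using assms unfolding admissible_radius_def by (meson le_less_trans order_trans)

lemma admissible_radius_if_less_korenblum_radius:
  assumes "korenblum_domination p w" "0 < c" "c < korenblum_radius p w"
  shows "admissible_radius p w c"
proof -
  obtain c' where "admissible_radius p w c'" "c < c'"
    using less_cSupD[of "{c. admissible_radius p w c}" c] assms
    by (auto simp: korenblum_radius_def korenblum_domination_def)
  with assms(2) show ?thesis
    by (auto intro: admissible_radius_antimono)
qed

lemma space_disk_area [simp]: "space disk_area = unit_disk"
  by (simp add: disk_area_def space_scale_measure)

lemma borel_measurable_disk_area_if_continuous_on:
  assumes "continuous_on unit_disk f"
  shows "f \<in> borel_measurable disk_area"
  using continuous_imp_measurable_on_sets_lebesgue[OF assms]
  by (simp add: disk_area_def cong: measurable_cong_sets)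

lemma AE_disk_area_if_countable:
  assumes "countable {z\<in>unit_disk. \<not> P z}"
  shows "AE z in disk_area. P z"
proof -
  let ?N = "{z\<in>unit_disk. \<not> P z}"
  have "?N \<in> null_sets lebesgue"
    using countable_imp_null_set_lborel[OF assms] by (rule null_sets_completionI)
  then have "?N \<in> null_sets (lebesgue_on unit_disk)"
    by (subst null_sets_restrict_space) auto
  then have "?N \<in> null_sets disk_area"
    by (auto simp: disk_area_def null_sets_def)
  then show ?thesis
    by (rule AE_I') auto
qed

text \<open>An open set is a countable union of compact sets. This prepares the disk for
  \<open>holomorphic_countable_zeros\<close>.\<close>

lemma open_imp_fsigma:
  fixes S :: "'a::euclidean_space set"
  assumes "open S"
  shows "fsigma S"
proof -
  obtain C :: "nat \<Rightarrow> 'a set" where "\<And>n. compact (C n)" "\<Union> (range C) = S"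
    by (rule open_Union_compact_subsets[OF assms]) blast
  then show ?thesis
    by (metis compact_imp_closed fsigma.intros)
qed

lemma holomorphic_AE_disk_nonzero:
  assumes "f holomorphic_on unit_disk" "z0 \<in> unit_disk" "f z0 \<noteq> 0"
  shows "AE z in disk_area. f z \<noteq> 0"
proof -
  have "countable {z\<in>unit_disk. f z = 0}"
  \<comment> \<open>The countability of zeros is a fact about nonconstant functions; a constant that
    is nonzero at \<open>z0\<close> has no zeros at all.\<close>
  proof (cases "f constant_on unit_disk")
    case True
    then have empty: "{z\<in>unit_disk. f z = 0} = {}"
      using assms(2,3) by (force simp: constant_on_def)
    show ?thesis
      unfolding empty by simp
  next
    case False
    then show ?thesis
      using assms(1) by (intro holomorphic_countable_zeros open_imp_fsigma) auto
  qed
  then show ?thesis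
    by (intro AE_disk_area_if_countable) simp
qed

text \<open>Since the integral of \<open>F\<close> is finite, it can be subtracted from: the
  nonnegative function \<open>(1 - k) F\<close> has integral zero, hence vanishes almost everywhere,
  and \<open>1 - k\<close> is strictly positive.\<close>

lemma nn_integral_zero_if_contraction_ge:
  fixes F :: "'a \<Rightarrow> real" and k :: "'a \<Rightarrow> real"
  assumes [measurable]: "F \<in> borel_measurable M" "k \<in> borel_measurable M"
    and F: "\<And>x. x \<in> space M \<Longrightarrow> 0 \<le> F x"
    and k: "\<And>x. x \<in> space M \<Longrightarrow> 0 \<le> k x \<and> k x < 1"
    and fin: "(\<integral>\<^sup>+ x. ennreal (F x) \<partial>M) < \<infinity>"
    and le: "(\<integral>\<^sup>+ x. ennreal (F x) \<partial>M) \<le> (\<integral>\<^sup>+ x. ennreal (k x * F x) \<partial>M)"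
  shows "AE x in M. F x = 0"
proof -
  have kF: "0 \<le> k x * F x" "k x * F x \<le> F x" if "x \<in> space M" for x
    using F[OF that] k[OF that] by (auto intro: mult_left_le_one_le)
  have "(\<integral>\<^sup>+ x. ennreal (k x * F x) \<partial>M) \<le> (\<integral>\<^sup>+ x. ennreal (F x) \<partial>M)"
    by (intro nn_integral_mono ennreal_leI kF)
  then have "(\<integral>\<^sup>+ x. ennreal (F x) - ennreal (k x * F x) \<partial>M) = 0"
    using fin le kF
    by (subst nn_integral_diff) (auto intro!: AE_I2 ennreal_leI diff_eq_0_ennreal)
  then have "AE x in M. ennreal (F x) - ennreal (k x * F x) = 0"
    by (subst (asm) nn_integral_0_iff_AE) auto
  then show ?thesis
  proof (rule AE_mp, intro AE_I2 impI)
    fix x assume x: "x \<in> space M" and "ennreal (F x) - ennreal (k x * F x) = 0"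
    \<comment> \<open>Subtraction in \<open>ennreal\<close> is truncated at zero, so a vanishing
      difference gives only this inequality; \<open>k x < 1\<close> turns it into
      \<open>F x = 0\<close>.\<close>
    then have "F x \<le> k x * F x"
      using kF[OF x] by (simp add: ennreal_minus ennreal_eq_0_iff)
    then show "F x = 0"
      using F[OF x] k[OF x] by (auto simp: mult_le_cancel_right1)
  qed
qed

lemma bergman_norm_less_top_iff:
  "bergman_norm p w f < top \<longleftrightarrow> (\<integral>\<^sup>+ z. ennreal (norm (f z) powr p * w z) \<partial>disk_area) < top"
  unfolding bergman_norm_def by (rule ennreal_powr_less_top_iff)

lemma bergman_norm_le_iff:
  assumes "0 < p"
  shows "bergman_norm p w f \<le> bergman_norm p w g \<longleftrightarrow>
    (\<integral>\<^sup>+ z. ennreal (norm (f z) powr p * w z) \<partial>disk_area)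
      \<le> (\<integral>\<^sup>+ z. ennreal (norm (g z) powr p * w z) \<partial>disk_area)"
  unfolding bergman_norm_def using assms by (intro ennreal_powr_le_iff) simp

text \<open>Puts both competitors into the space: \<open>\<phi>\<close> will be a constant
  \<open>c\<close> and then the identity.\<close>

lemma bergman_space_mult_le_one:
  assumes "0 < p" "disk_weight w" "h \<in> bergman_space p w"
    and "\<phi> holomorphic_on unit_disk" "\<And>z. z \<in> unit_disk \<Longrightarrow> norm (\<phi> z) \<le> 1"
  shows "(\<lambda>z. \<phi> z * h z) \<in> bergman_space p w"
proof -
  have "(\<integral>\<^sup>+ z. ennreal (norm (\<phi> z * h z) powr p * w z) \<partial>disk_area)
      \<le> (\<integral>\<^sup>+ z. ennreal (norm (h z) powr p * w z) \<partial>disk_area)"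
    using assms(1,2,5)
    by (intro nn_integral_mono ennreal_leI mult_right_mono powr_mono2)
      (auto simp: disk_weight_def norm_mult intro!: mult_left_le_one_le)
  also have "\<dots> < \<infinity>"
    using assms(3) by (simp add: bergman_space_def bergman_norm_less_top_iff)
  finally show ?thesis
    using assms(3,4)
    by (auto simp: bergman_space_def bergman_norm_less_top_iff intro: holomorphic_intros)
qed

theorem proposition1:
  fixes p :: real and w :: "complex \<Rightarrow> real"
  assumes "0 < p"
    and "disk_weight w"
    and "\<exists>f\<in>bergman_space p w. \<exists>z\<in>unit_disk. f z \<noteq> 0"
    and "korenblum_domination p w"
  shows "korenblum_radius p w < 1"
proof (rule ccontr)
  assume radius: "\<not> korenblum_radius p w < 1"
  obtain h z0 where h: "h \<in> bergman_space p w" and z0: "z0 \<in> unit_disk" "h z0 \<noteq> 0"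
    using assms(3) by auto
  have hol: "h holomorphic_on unit_disk"
    using h by (simp add: bergman_space_def)
  have [measurable]: "w \<in> borel_measurable disk_area"
    using assms(2) by (simp add: disk_weight_def)
  have w: "0 \<le> w z" if "z \<in> unit_disk" for z
    using assms(2) that by (simp add: disk_weight_def)
  have [measurable]: "h \<in> borel_measurable disk_area"
    "(\<lambda>z. norm z) \<in> borel_measurable disk_area"
    by (auto intro!: borel_measurable_disk_area_if_continuous_on holomorphic_on_imp_continuous_on
        hol continuous_intros)
  let ?F = "\<lambda>z. norm (h z) powr p * w z"
  let ?I = "\<integral>\<^sup>+ z. ennreal (?F z) \<partial>disk_area"
  let ?J = "\<integral>\<^sup>+ z. ennreal (norm z powr p * ?F z) \<partial>disk_area"
  have I: "?I < \<infinity>"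
    using h by (simp add: bergman_space_def bergman_norm_less_top_iff)
  have cI: "ennreal (c powr p) * ?I \<le> ?J" if "0 < c" "c < 1" for c
  proof -
    \<comment> \<open>The negated claim makes the radius at least 1, which exceeds
      \<open>c\<close>.\<close>
    have "admissible_radius p w c"
      using radius assms(4) that by (intro admissible_radius_if_less_korenblum_radius) auto
    moreover have "(\<lambda>z. of_real c * h z) \<in> bergman_space p w"
      using assms h that by (intro bergman_space_mult_le_one) auto
    moreover have "(\<lambda>z. z * h z) \<in> bergman_space p w"
      using assms h by (intro bergman_space_mult_le_one) (auto intro: holomorphic_intros)
    moreover have "norm (of_real c * h z) \<le> norm (z * h z)" if "c \<le> norm z" for z
      using that \<open>0 < c\<close> by (simp add: norm_mult mult_right_mono)
    ultimately have "bergman_norm p w (\<lambda>z. of_real c * h z) \<le> bergman_norm p w (\<lambda>z. z * h z)"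
      unfolding admissible_radius_def by simp
    then have "(\<integral>\<^sup>+ z. ennreal (c powr p * ?F z) \<partial>disk_area) \<le> ?J"
      using assms(1) that by (simp add: bergman_norm_le_iff norm_mult powr_mult mult.assoc)
    also have "(\<integral>\<^sup>+ z. ennreal (c powr p * ?F z) \<partial>disk_area) = ennreal (c powr p) * ?I"
      by (simp add: ennreal_mult' nn_integral_cmult)
    finally show ?thesis .
  qed
  have "?I \<le> ?J"
  proof (rule tendsto_upperbound)
    have "((\<lambda>c. ennreal (c powr p)) \<longlongrightarrow> ennreal (1 powr p)) (at_left 1)"
      by (intro tendsto_ennrealI tendsto_intros) auto
    \<comment> \<open>Multiplication by a fixed \<open>ennreal\<close> factor preserves limits when
      that factor is finite, which is what \<open>I\<close> provides.\<close>
    then show "((\<lambda>c. ennreal (c powr p) * ?I) \<longlongrightarrow> ?I) (at_left 1)"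
      using I by (auto dest: ennreal_tendsto_cmult[where c = ?I, rotated] simp: mult.commute)
    show "\<forall>\<^sub>F c in at_left 1. ennreal (c powr p) * ?I \<le> ?J"
      using cI by (intro eventually_at_leftI[of 0]) auto
  qed simp
  \<comment> \<open>The contraction factor is \<open>norm z powr p\<close>, strictly below 1 because
    the disk is open and \<open>p\<close> is positive.\<close>
  then have "AE z in disk_area. ?F z = 0"
    using I w assms(1)
    by (intro nn_integral_zero_if_contraction_ge[where k = "\<lambda>z. norm z powr p"])
      (use powr_less_mono2[of p _ 1] in auto)
  then have "AE z in disk_area. w z = 0"
    using holomorphic_AE_disk_nonzero[OF hol z0] by eventually_elim simp
  then have "(\<integral>\<^sup>+ z. ennreal (w z) \<partial>disk_area) = 0"
    by (subst nn_integral_0_iff_AE) auto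
  then show False
    using assms(2) by (simp add: disk_weight_def)
qed

end
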